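(* Let $V$ be a finite set, let $\mathcal{M}=(V,\mathcal{F})$ be a matroid all of whose bases have cardinality $N$, and let $f:2^V\to\mathbb{R}$ be an increasing set function with submodularity ratio $\gamma$ and curvature $\alpha$. Let $S^*$ be an optimal solution of $$\min_{S\subseteq V} f(S)\quad\text{s.t.}\quad S\in\mathcal{F},\ |S|=N,$$ and let $S^{\mathsf f}$ be any output of the forward greedy algorithm applied to this problem. Assume $\gamma>0$, $\alpha<1$ and $f(S^* )\neq f(\emptyset)$. Then $$\frac{f(S^{\mathsf f})-f(\emptyset)}{f(S^* )-f(\emptyset)}\le\frac{1}{\gamma(1-\alpha)}.$$
   Context: Notation: $j$ and $\{j\}$ are identified for singletons; $\rho_j(S)=f(S\cup j)-f(S)$ for $S\subseteq V$, $j\in V$. The function $f$ is not assumed normalized (possibly $f(\emptyset)\ne 0$). $f$ is increasing if $f(S)\le f(R)$ for all $S\subseteq R\subseteq V$. The submodularity ratio of an increasing $f$ is the largest $\gamma\in\mathbb{R}_+$ such that $\gamma\rho_j(R)\le\rho_j(S)$ for all $S\subseteq R\subseteq V$ and all $j\in V\setminus R$ (one has $\gamma\in[0,1]$). The curvature of an increasing $f$ is the smallest $\alpha\in\mathbb{R}_+$ such that $\rho_j(R)\ge(1-\alpha)\rho_j(S)$ for all $S\subseteq R\subseteq V$ and all $j\in V\setminus R$ (one has $\alpha\in[0,1]$). A matroid $(V,\mathcal{F})$ is given by its collection $\mathcal{F}$ of independent sets; bases are the independent sets of maximum cardinality. Forward greedy algorithm: start with $S^0=\emptyset$ and with no element of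 $V$ marked as considered. For $t=1,\dots,N$: repeatedly choose $j\in\arg\min\rho_j(S^{t-1})$ over all not yet considered elements $j\in V$ (ties broken arbitrarily) and mark $j$ as considered (permanently); if $S^{t-1}\cup j\notin\mathcal{F}$, discard $j$ and choose again; otherwise set $s_t=j$, $S^t=S^{t-1}\cup j$ and proceed to the next $t$. The output is $S^{\mathsf f}=S^N$. *)

theory Defs
  imports Complex_Main
begin

definition marginal :: "('a set \<Rightarrow> real) \<Rightarrow> 'a set \<Rightarrow> 'a \<Rightarrow> real" where
  "marginal f S j = f (insert j S) - f S"

text \<open>
  Submodularity ratio and curvature are relations rather than functions: for increasing \<open>f\<close>,
  the smallest curvature bound always exists, but the largest submodularity ratio bound does not
  when \<open>f\<close> is constant on the subsets of \<open>V\<close> (then every nonnegative number is admissible).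
\<close>

definition submodularity_ratio_bound :: "'a set \<Rightarrow> ('a set \<Rightarrow> real) \<Rightarrow> real \<Rightarrow> bool" where
  "submodularity_ratio_bound V f g \<longleftrightarrow>
     g \<ge> 0 \<and>
     (\<forall>S R. S \<subseteq> R \<and> R \<subseteq> V \<longrightarrow> (\<forall>j \<in> V - R. g * marginal f R j \<le> marginal f S j))"

definition is_submodularity_ratio :: "'a set \<Rightarrow> ('a set \<Rightarrow> real) \<Rightarrow> real \<Rightarrow> bool" where
  "is_submodularity_ratio V f g \<longleftrightarrow>
     submodularity_ratio_bound V f g \<and> (\<forall>g'. submodularity_ratio_bound V f g' \<longrightarrow> g' \<le> g)"

definition curvature_bound :: "'a set \<Rightarrow> ('a set \<Rightarrow> real) \<Rightarrow> real \<Rightarrow> bool" where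
  "curvature_bound V f a \<longleftrightarrow>
     a \<ge> 0 \<and>
     (\<forall>S R. S \<subseteq> R \<and> R \<subseteq> V \<longrightarrow> (\<forall>j \<in> V - R. marginal f R j \<ge> (1 - a) * marginal f S j))"

definition is_curvature :: "'a set \<Rightarrow> ('a set \<Rightarrow> real) \<Rightarrow> real \<Rightarrow> bool" where
  "is_curvature V f a \<longleftrightarrow>
     curvature_bound V f a \<and> (\<forall>a'. curvature_bound V f a' \<longrightarrow> a \<le> a')"

definition matroid :: "'a set \<Rightarrow> 'a set set \<Rightarrow> bool" where
  "matroid V \<F> \<longleftrightarrow>
     finite V \<and> \<F> \<subseteq> Pow V \<and> {} \<in> \<F> \<and>
     (\<forall>A B. B \<in> \<F> \<and> A \<subseteq> B \<longrightarrow> A \<in> \<F>) \<and>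
     (\<forall>A B. A \<in> \<F> \<and> B \<in> \<F> \<and> card A < card B \<longrightarrow> (\<exists>x \<in> B - A. insert x A \<in> \<F>))"

definition matroid_basis :: "'a set set \<Rightarrow> 'a set \<Rightarrow> bool" where
  "matroid_basis \<F> B \<longleftrightarrow> B \<in> \<F> \<and> (\<forall>A \<in> \<F>. card A \<le> card B)"

text \<open>
  In a state \<open>t S C\<close>, the set \<open>S\<close> is the partial solution after \<open>t\<close> completed iterations and
  \<open>C\<close> is the set of elements considered so far.  Ties in the choice of \<open>j\<close> are resolved
  nondeterministically, so every run of the algorithm is covered.
\<close>

inductive forward_greedy_state ::
  "'a set \<Rightarrow> 'a set set \<Rightarrow> ('a set \<Rightarrow> real) \<Rightarrow> nat \<Rightarrow> nat \<Rightarrow> 'a set \<Rightarrow> 'a set \<Rightarrow> bool"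
  for V \<F> f N where
  init: "forward_greedy_state V \<F> f N 0 {} {}"
| discard: "forward_greedy_state V \<F> f N t S (insert j C)"
    if "forward_greedy_state V \<F> f N t S C" and "t < N"
      and "is_arg_min (marginal f S) (\<lambda>i. i \<in> V - C) j" and "insert j S \<notin> \<F>"
| select: "forward_greedy_state V \<F> f N (Suc t) (insert j S) (insert j C)"
    if "forward_greedy_state V \<F> f N t S C" and "t < N"
      and "is_arg_min (marginal f S) (\<lambda>i. i \<in> V - C) j" and "insert j S \<in> \<F>"

definition forward_greedy_output ::
  "'a set \<Rightarrow> 'a set set \<Rightarrow> ('a set \<Rightarrow> real) \<Rightarrow> nat \<Rightarrow> 'a set \<Rightarrow> bool" where
  "forward_greedy_output V \<F> f N S \<longleftrightarrow> (\<exists>C. forward_greedy_state V \<F> f N N S C)"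

end

theory Submission
  imports Defs
begin

text \<open>
  Both \<open>f Sf - f {}\<close> and \<open>f Sopt - f {}\<close> are compared with the modular weight
  \<open>\<Sum>e\<in>Sopt. marginal f {} e\<close>.  Adding the elements of \<open>Sopt\<close> one at a time, the curvature
  bounds each increment from below by \<open>1 - \<alpha>\<close> times the marginal at the empty set, so
  \<open>(1 - \<alpha>)\<close> times the weight is at most \<open>f Sopt - f {}\<close>
  (\<open>curvature_bound_sum_marginals_le\<close>).

  On the greedy side, \<open>\<gamma> * (f Sf - f {})\<close> is at most the weight, because the greedy selections
  can be charged injectively to the elements of \<open>Sopt\<close>: if \<open>s\<close> is selected at the partial
  solution \<open>S\<close>, when the considered elements are \<open>C\<close>, then it may be charged to any
  \<open>e \<in> Sopt - C\<close>, since \<open>marginal f S s \<le> marginal f S e\<close> by the greedy choice and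
  \<open>\<gamma> * marginal f S e \<le> marginal f {} e\<close> by the submodularity ratio.  Here the matroid enters:
  every considered element is in \<open>S\<close> or dependent on it, so at most \<open>card S\<close> elements of the
  independent set \<open>Sopt\<close> have been considered
  (\<open>forward_greedy_card_considered_independent_le\<close>).  As the considered sets only grow, these
  cardinality bounds suffice for an injective charging, obtained by serving the latest
  selections, which have the fewest choices, first.
\<close>

lemma matroid_subset:
  assumes "matroid V \<F>" and "B \<in> \<F>" and "A \<subseteq> B"
  shows "A \<in> \<F>"
proof -
  have "\<forall>A B. B \<in> \<F> \<and> A \<subseteq> B \<longrightarrow> A \<in> \<F>"
    using assms(1) unfolding matroid_def by (elim conjE)
  then show ?thesis using assms(2,3) by blast
qed

lemma matroid_exchange:
  assumes "matroid V \<F>" and "A \<in> \<F>" and "B \<in> \<F>" and "card A < card B"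
  obtains x where "x \<in> B - A" "insert x A \<in> \<F>"
proof -
  have "\<forall>A B. A \<in> \<F> \<and> B \<in> \<F> \<and> card A < card B \<longrightarrow> (\<exists>x \<in> B - A. insert x A \<in> \<F>)"
    using assms(1) unfolding matroid_def by (elim conjE)
  then have "\<exists>x \<in> B - A. insert x A \<in> \<F>" using assms(2-4) by simp
  then show ?thesis using that by blast
qed

lemma forward_greedy_state_subsets:
  assumes "forward_greedy_state V \<F> f N t S C"
  shows "S \<subseteq> C" and "C \<subseteq> V"
  using assms by (induction rule: forward_greedy_state.induct) (auto simp: is_arg_min_def)

lemma forward_greedy_state_card:
  assumes "forward_greedy_state V \<F> f N t S C" and "finite V"
  shows "card S = t"
  using assms
proof (induction rule: forward_greedy_state.induct)
  case init
  then show ?case by simp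
next
  case (discard t S C j)
  then show ?case by blast
next
  case (select t S C j)
  have "j \<notin> S" and "finite S"
    using forward_greedy_state_subsets[OF select.hyps(1)] select.hyps(3) \<open>finite V\<close>
    by (auto simp: is_arg_min_def intro: finite_subset)
  with select show ?case by simp
qed

lemma forward_greedy_state_independent:
  assumes "forward_greedy_state V \<F> f N t S C" and "matroid V \<F>"
  shows "S \<in> \<F>"
  using assms by (induction rule: forward_greedy_state.induct) (auto simp: matroid_def)

text \<open>
  A discarded element is dependent on the partial solution that rejects it, and dependent sets
  are closed under supersets, so rejection stays justified as the solution grows.
\<close>

lemma forward_greedy_state_considered_dependent:
  assumes "forward_greedy_state V \<F> f N t S C" and "matroid V \<F>" and "x \<in> C - S"
  shows "insert x S \<notin> \<F>"
  using assms
proof (induction rule: forward_greedy_state.induct)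
  case init
  then show ?case by simp
next
  case (discard t S C j)
  then show ?case by auto
next
  case (select t S C j)
  then have "insert x S \<notin> \<F>" by auto
  moreover have "insert x S \<subseteq> insert x (insert j S)" by blast
  ultimately show ?case
    using matroid_subset[OF \<open>matroid V \<F>\<close>] by blast
qed

text \<open>
  If more than \<open>t\<close> elements of \<open>I\<close> had been considered, the exchange property would extend the
  partial solution by a considered element, which is impossible.
\<close>

lemma forward_greedy_card_considered_independent_le:
  assumes state: "forward_greedy_state V \<F> f N t S C" and matroid: "matroid V \<F>"
    and "I \<in> \<F>"
  shows "card (I \<inter> C) \<le> t"
proof (rule ccontr)
  have "finite V" using matroid by (simp add: matroid_def)
  assume "\<not> card (I \<inter> C) \<le> t"
  then have "card S < card (I \<inter> C)"
    using forward_greedy_state_card[OF state \<open>finite V\<close>] by simp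
  moreover have "I \<inter> C \<in> \<F>"
    using matroid_subset[OF matroid \<open>I \<in> \<F>\<close>] by simp
  ultimately obtain x where "x \<in> I \<inter> C - S" "insert x S \<in> \<F>"
    using matroid_exchange[OF matroid forward_greedy_state_independent[OF state matroid]]
    by metis
  then show False
    using forward_greedy_state_considered_dependent[OF state matroid] by blast
qed

text \<open>
  The charging argument.  Quantifying over all \<open>A\<close> that contain the considered part of \<open>I\<close> lets
  the induction run along the algorithm although the charging is chosen backwards: a discard only
  reduces the admissible sets \<open>A\<close>, and a selection is charged to an arbitrary element of \<open>A\<close>
  not yet considered, leaving the rest of \<open>A\<close> for the earlier selections.
\<close>

lemma forward_greedy_state_charging:
  assumes "forward_greedy_state V \<F> f N t S C" and "matroid V \<F>"
    and "submodularity_ratio_bound V f g" and "I \<in> \<F>"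
    and "A \<subseteq> I" and "I \<inter> C \<subseteq> A" and "card A = t"
  shows "g * (f S - f {}) \<le> (\<Sum>e\<in>A. marginal f {} e)"
  using assms
proof (induction arbitrary: A rule: forward_greedy_state.induct)
  case init
  then have "I \<subseteq> V" and "finite V"
    by (auto simp: matroid_def)
  then have "finite A"
    using \<open>A \<subseteq> I\<close> by (meson finite_subset)
  with init show ?case by simp
next
  case (discard t S C j)
  then show ?case by blast
next
  case (select t S C j)
  have "I \<subseteq> V" and "finite V"
    using select.prems unfolding matroid_def by auto
  then have "finite A"
    using select.prems by (meson finite_subset)
  have "card (I \<inter> C) \<le> t"
    using forward_greedy_card_considered_independent_le select.hyps(1) select.prems by metis
  then have "\<not> A \<subseteq> I \<inter> C"
    using card_mono[of "I \<inter> C" A] finite_subset[OF \<open>I \<subseteq> V\<close> \<open>finite V\<close>] select.prems(6) by auto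
  then obtain e where e: "e \<in> A" "e \<notin> C"
    using select.prems by blast
  have IH: "g * (f S - f {}) \<le> (\<Sum>x\<in>A - {e}. marginal f {} x)"
  proof (rule select.IH)
    show "I \<inter> C \<subseteq> A - {e}" using select.prems e by blast
    show "card (A - {e}) = t" using select.prems e \<open>finite A\<close> by simp
  qed (use select.prems in auto)
  have "e \<in> V - C" using e select.prems \<open>I \<subseteq> V\<close> by blast
  then have "marginal f S j \<le> marginal f S e"
    using select.hyps(3) by (simp add: is_arg_min_linorder)
  moreover have "g \<ge> 0"
    using select.prems by (simp add: submodularity_ratio_bound_def)
  ultimately have "g * marginal f S j \<le> g * marginal f S e"
    by (simp add: mult_left_mono)
  also have "\<dots> \<le> marginal f {} e"
    using select.prems(2) \<open>e \<in> V - C\<close> forward_greedy_state_subsets[OF select.hyps(1)]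
    unfolding submodularity_ratio_bound_def by blast
  finally have "g * (f (insert j S) - f S) \<le> marginal f {} e"
    by (simp add: marginal_def)
  moreover have "g * (f (insert j S) - f {}) = g * (f S - f {}) + g * (f (insert j S) - f S)"
    by (simp add: algebra_simps)
  ultimately show ?case
    using IH sum.remove[OF \<open>finite A\<close> e(1), of "marginal f {}"] by linarith
qed

lemma curvature_bound_sum_marginals_le:
  assumes "curvature_bound V f a" and "finite A" and "A \<subseteq> V"
  shows "(1 - a) * (\<Sum>e\<in>A. marginal f {} e) \<le> f A - f {}"
  using assms(2,3)
proof (induction rule: finite_induct)
  case empty
  then show ?case by simp
next
  case (insert x A)
  then have "(1 - a) * marginal f {} x \<le> marginal f A x"
    using assms(1) unfolding curvature_bound_def by blast
  with insert show ?case
    by (simp add: marginal_def algebra_simps)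
qed

theorem theorem1:
  fixes V :: "'a set" and \<F> :: "'a set set" and f :: "'a set \<Rightarrow> real"
    and N :: nat and \<gamma> \<alpha> :: real and Sopt Sf :: "'a set"
  assumes "finite V"
    and "matroid V \<F>"
    and "\<And>B. matroid_basis \<F> B \<Longrightarrow> card B = N"
    and "mono_on (Pow V) f"
    and "is_submodularity_ratio V f \<gamma>"
    and "is_curvature V f \<alpha>"
    and "is_arg_min f (\<lambda>S. S \<subseteq> V \<and> S \<in> \<F> \<and> card S = N) Sopt"
    and "forward_greedy_output V \<F> f N Sf"
    and "\<gamma> > 0"
    and "\<alpha> < 1"
    and "f Sopt \<noteq> f {}"
  shows "(f Sf - f {}) / (f Sopt - f {}) \<le> 1 / (\<gamma> * (1 - \<alpha>))"
proof -
  let ?weight = "\<Sum>e\<in>Sopt. marginal f {} e"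
  have Sopt: "Sopt \<subseteq> V" "Sopt \<in> \<F>" "card Sopt = N"
    using assms(7) by (auto simp: is_arg_min_def)
  obtain C where "forward_greedy_state V \<F> f N N Sf C"
    using assms(8) unfolding forward_greedy_output_def by blast
  then have "\<gamma> * (f Sf - f {}) \<le> ?weight"
    using forward_greedy_state_charging[of V \<F> f N N Sf C \<gamma> Sopt Sopt] assms(2,5) Sopt
    by (simp add: is_submodularity_ratio_def)
  then have "\<gamma> * (1 - \<alpha>) * (f Sf - f {}) \<le> (1 - \<alpha>) * ?weight"
    using mult_left_mono[of "\<gamma> * (f Sf - f {})" ?weight "1 - \<alpha>"] \<open>\<alpha> < 1\<close>
    by (simp add: mult_ac)
  also have "\<dots> \<le> f Sopt - f {}"
    using curvature_bound_sum_marginals_le assms(1,6) Sopt(1)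
    unfolding is_curvature_def by (metis finite_subset)
  finally have "\<gamma> * (1 - \<alpha>) * (f Sf - f {}) \<le> f Sopt - f {}" .
  moreover have "f Sopt - f {} > 0"
    using mono_onD[OF assms(4), of "{}" Sopt] Sopt(1) assms(11) by simp
  moreover have "\<gamma> * (1 - \<alpha>) > 0"
    using assms(9,10) by simp
  ultimately show ?thesis
    by (simp add: divide_simps mult.commute)
qed

end
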